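(* Let $n\ge 1$ and $d\ge 2$. (i) For every data set $\mathcal D$, the circumcenter policy $\pi$ (treating a circumcenter $\hat c(C(\mathcal D))$ of $C(\mathcal D)$ as if it were the true cost) satisfies $$\mathcal{WCR}^{\pi}(\mathcal D)\ \le\ \mathbf 1\{\alpha(C(\mathcal D))<\pi/2\}\,\sin\alpha(C(\mathcal D))+\mathbf 1\{\alpha(C(\mathcal D))\ge \pi/2\}.$$ (ii) For every angle $\bar\alpha\in[0,\pi]$ there exists an information set $C\subseteq S^d$, $C\neq\emptyset$, with $\alpha(C)=\bar\alpha$ such that no policy can achieve a worst-case regret over $C$ lower than $\sin\bar\alpha$ if $\bar\alpha<\pi/2$, respectively lower than $1$ if $\bar\alpha\ge\pi/2$. That is, for every map $\pi$ assigning to each $(\mathcal X,f)\in\mathcal B\times\mathcal F$ an action $x^\pi\in\mathcal X$, $$\sup_{c^\star\in C,\ \mathcal X\in\mathcal B,\ f\in\mathcal F}\ \bigl(f(x^\pi)-f(x^\star)\bigr)'c^\star\ \ge\ \begin{cases}\sin\bar\alpha,&\bar\alpha<\pi/2,\\ 1,&\bar\alpha\ge\pi/2,\end{cases}$$ where $x^\star\in\psi(c^\star,\mathcal X,f)$.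
   Context: Notation: $S^d$ is the unit Euclidean sphere of $\mathbb R^d$; $\|\cdot\|$ is the Euclidean norm; $\mathcal B$ is the set of nonempty compact subsets of $\mathbb R^n$ of diameter at most $1$; $\mathcal F$ is the set of $1$-Lipschitz functions $\mathbb R^n\to\mathbb R^d$. For $c\in\mathbb R^d$, $\mathcal X\in\mathcal B$, $f\in\mathcal F$, put $\psi(c,\mathcal X,f)=\arg\min_{x\in\mathcal X} f(x)'c$ (a set, possibly with several elements). Angles: $\theta(c,\hat c)=\arccos\frac{c'\hat c}{\|c\|\|\hat c\|}$, with $\theta$ equal to $0$ if one of the vectors is $0$. For a nonempty set $C\subseteq \mathbb R^d$, the uncertainty angle is $\alpha(C)=\inf_{\hat c\in S^d}\sup_{c\in C}\theta(c,\hat c)$, and a circumcenter $\hat c(C)\in S^d$ is any minimizer (one always exists). Data: there is an unknown true cost $c^\star\in S^d$. A data set is $\mathcal D=\{(\mathcal X_i,f_i,x_i^\star)\}_{i=1,\dots,N}$ with $\mathcal X_i\in\mathcal B$, $f_i\in\mathcal F$, and $x_i^\star\in\psi(c^\star,\mathcal X_i,f_i)$. The set of consistent costs is $C(\mathcal D)=\{c\in S^d:\ c'f_i(x_i^\star)\le c'f_i(x)\ \forall x\in\mathcal X_i,\ i=1,\dots,N\}$ (nonempty since it contains $c^\star$). Policies and regret: a policy $\pi$ maps the data and a new instance $(\mathcal X,f)\in\mathcal B\times\mathcal F$ to an action $x^\pi\in\mathcal X$. Its worst-case regret is $\mathcal{WCR}^\pi(\mathcal D)=\sup_{c^\star\in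 C(\mathcal D),\,\mathcal X\in\mathcal B,\,f\in\mathcal F}\bigl(f(x^\pi)-f(x^\star)\bigr)'c^\star$, where $x^\star\in\psi(c^\star,\mathcal X,f)$. The circumcenter policy chooses $x^\pi\in\psi(\hat c(C(\mathcal D)),\mathcal X,f)$ (arbitrary selection in case of ties). *)

theory Defs
  imports "HOL-Analysis.Analysis"
begin

definition instance_sets :: "(real ^ 'n) set set" where
  "instance_sets = {X. X \<noteq> {} \<and> compact X \<and> diameter X \<le> 1}"

definition feature_maps :: "(real ^ 'n \<Rightarrow> real ^ 'd) set" where
  "feature_maps = {f. 1-lipschitz_on UNIV f}"

definition opt_actions ::
    "real ^ 'd \<Rightarrow> (real ^ 'n) set \<Rightarrow> (real ^ 'n \<Rightarrow> real ^ 'd) \<Rightarrow> (real ^ 'n) set" where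
  "opt_actions c X f = {x. is_arg_min (\<lambda>x. f x \<bullet> c) (\<lambda>x. x \<in> X) x}"

definition angle :: "real ^ 'd \<Rightarrow> real ^ 'd \<Rightarrow> real" where
  "angle c c' = (if c = 0 \<or> c' = 0 then 0 else arccos ((c \<bullet> c') / (norm c * norm c')))"

text \<open>Angles lie in \<open>[0, pi]\<close>, so the real-valued suprema and infima below are the true ones
  whenever \<open>C\<close> is nonempty.\<close>

definition uncertainty_angle :: "(real ^ 'd) set \<Rightarrow> real" where
  "uncertainty_angle C = (INF c'\<in>sphere 0 1. SUP c\<in>C. angle c c')"

definition circumcenter :: "(real ^ 'd) set \<Rightarrow> real ^ 'd \<Rightarrow> bool" where
  "circumcenter C c' \<longleftrightarrow>
     is_arg_min (\<lambda>c'. SUP c\<in>C. angle c c') (\<lambda>c'. c' \<in> sphere 0 1) c'"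

type_synonym ('n, 'd) dataset =
  "((real ^ 'n) set \<times> (real ^ 'n \<Rightarrow> real ^ 'd) \<times> (real ^ 'n)) list"

definition valid_dataset :: "('n::finite, 'd::finite) dataset \<Rightarrow> bool" where
  "valid_dataset D \<longleftrightarrow>
     (\<exists>c\<in>sphere 0 1. \<forall>(X, f, x)\<in>set D.
        X \<in> instance_sets \<and> f \<in> feature_maps \<and> x \<in> opt_actions c X f)"

definition consistent_costs :: "('n::finite, 'd::finite) dataset \<Rightarrow> (real ^ 'd) set" where
  "consistent_costs D =
     {c \<in> sphere 0 1. \<forall>(X, f, x)\<in>set D. \<forall>y\<in>X. c \<bullet> f x \<le> c \<bullet> f y}"

text \<open>The map from new instances to actions that a policy yields once the data is fixed.\<close>

type_synonym ('n, 'd) decision_rule =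
  "(real ^ 'n) set \<Rightarrow> (real ^ 'n \<Rightarrow> real ^ 'd) \<Rightarrow> real ^ 'n"

definition feasible_rule :: "('n::finite, 'd::finite) decision_rule \<Rightarrow> bool" where
  "feasible_rule p \<longleftrightarrow> (\<forall>X\<in>instance_sets. \<forall>f\<in>feature_maps. p X f \<in> X)"

text \<open>For a feasible rule and a nonempty set of unit costs the regrets form a nonempty subset of
  \<open>[0, 1]\<close>, so the real-valued supremum is the true one. The regret does not depend on which
  optimal action \<open>x\<close> is used.\<close>

definition worst_case_regret ::
    "(real ^ 'd) set \<Rightarrow> ('n::finite, 'd::finite) decision_rule \<Rightarrow> real" where
  "worst_case_regret C p =
     Sup {(f (p X f) - f x) \<bullet> c | c X f x.
       c \<in> C \<and> X \<in> instance_sets \<and> f \<in> feature_maps \<and> x \<in> opt_actions c X f}"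

text \<open>The circumcenter may be chosen freely, but only as a function of the data; ties between
  optimal actions may be broken arbitrarily in each instance.\<close>

definition circumcenter_policy ::
    "(('n::finite, 'd::finite) dataset \<Rightarrow> ('n, 'd) decision_rule) \<Rightarrow> bool" where
  "circumcenter_policy \<pi> \<longleftrightarrow>
     (\<forall>D. valid_dataset D \<longrightarrow>
        (\<exists>c'. circumcenter (consistent_costs D) c' \<and>
           (\<forall>X\<in>instance_sets. \<forall>f\<in>feature_maps. \<pi> D X f \<in> opt_actions c' X f)))"

end

theory Submission imports Defs begin

text \<open>Write \<open>v = f(x\<^sup>\<pi>) - f(x\<^sup>\<star>)\<close>, a vector of norm at most 1. Optimality of \<open>x\<^sup>\<pi>\<close>
  for the circumcenter \<open>c'\<close> means \<open>v \<bullet> c' \<le> 0\<close>, so only the component of \<open>c\<^sup>\<star>\<close> orthogonal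
  to \<open>c'\<close> can contribute positively to \<open>v \<bullet> c\<^sup>\<star>\<close>, and its length is the sine of the angle
  between \<open>c\<^sup>\<star>\<close> and \<open>c'\<close>.
  For the lower bound take a spherical cap of radius \<open>a\<close> around \<open>e\<close> and an instance with two
  actions whose features differ by a unit vector \<open>u\<close> orthogonal to \<open>e\<close>. The cap contains two
  costs, mirror images in the direction \<open>u\<close>, for which the actions are ranked in opposite
  order with gap \<open>sin a\<close> (respectively 1).\<close>

section \<open>Angles between unit vectors, and the distance to a circumcenter\<close>

lemma angle_unit:
  assumes "norm c = 1" "norm c' = 1"
  shows "angle c c' = arccos (c \<bullet> c')"
  using assms by (auto simp: angle_def)

lemma inner_unit_bounds:
  fixes c c' :: "'a::real_inner"
  assumes "norm c = 1" "norm c' = 1"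
  shows "- 1 \<le> c \<bullet> c'" "c \<bullet> c' \<le> 1"
  using Cauchy_Schwarz_ineq2[of c c'] assms by auto

lemma angle_unit_bounds:
  assumes "norm c = 1" "norm c' = 1"
  shows "0 \<le> angle c c'" "angle c c' \<le> pi"
  using inner_unit_bounds[OF assms] by (auto simp: angle_unit[OF assms] arccos_lbound arccos_ubound)

lemma bdd_above_angle:
  assumes "C \<subseteq> sphere 0 1" "norm c' = 1"
  shows "bdd_above ((\<lambda>c. angle c c') ` C)"
  using assms angle_unit_bounds(2) by (intro bdd_aboveI[of _ pi]) (auto simp: subset_iff)

lemma angle_le_SUP:
  assumes "C \<subseteq> sphere 0 1" "norm c' = 1" "c \<in> C"
  shows "angle c c' \<le> (SUP c\<in>C. angle c c')"
  using assms bdd_above_angle by (intro cSUP_upper) auto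

text \<open>A circumcenter attains the infimum over all centers, so its own largest angle to
  \<open>C\<close> is that infimum.\<close>

lemma angle_le_uncertainty_angle:
  assumes "circumcenter C c'" "C \<subseteq> sphere 0 1" "c \<in> C"
  shows "angle c c' \<le> uncertainty_angle C"
proof -
  have c': "norm c' = 1"
    using assms(1) by (auto simp: circumcenter_def is_arg_min_def)
  have "(SUP c\<in>C. angle c c') \<le> uncertainty_angle C"
    unfolding uncertainty_angle_def using assms(1) c'
    by (intro cINF_greatest) (auto simp: circumcenter_def is_arg_min_linorder)
  then show ?thesis
    using angle_le_SUP[OF assms(2) c' assms(3)] by linarith
qed

lemma inner_le_sin_angle:
  assumes "norm c = 1" "norm c' = 1" "norm v \<le> 1" "v \<bullet> c' \<le> 0" "angle c c' \<le> pi / 2"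
  shows "v \<bullet> c \<le> sin (angle c c')"
proof -
  define t where "t = c \<bullet> c'"
  have t: "-1 \<le> t" "t \<le> 1"
    using inner_unit_bounds assms unfolding t_def by auto
  have ang: "angle c c' = arccos t"
    using assms angle_unit unfolding t_def by auto
  have "cos (angle c c') \<ge> 0"
    using assms(5) angle_unit_bounds(1)[OF assms(1,2)] by (intro cos_ge_zero) auto
  \<comment> \<open>This is where the angle bound \<open>pi / 2\<close> enters: with
    \<open>t\<close> nonnegative, the component of \<open>c\<close> along \<open>c'\<close>
    contributes \<open>t * (v \<bullet> c')\<close>, which is at most 0.\<close>
  then have "0 \<le> t"
    using t ang by simp
  have "v \<bullet> c = t * (v \<bullet> c') + v \<bullet> (c - t *\<^sub>R c')"
    by (simp add: inner_diff_right)
  also have "\<dots> \<le> v \<bullet> (c - t *\<^sub>R c')"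
    using \<open>0 \<le> t\<close> assms(4) by (simp add: mult_nonneg_nonpos)
  also have "\<dots> \<le> norm v * norm (c - t *\<^sub>R c')"
    by (rule norm_cauchy_schwarz)
  also have "\<dots> \<le> norm (c - t *\<^sub>R c')"
    using assms(3) by (simp add: mult_left_le_one_le)
  also have "(norm (c - t *\<^sub>R c'))\<^sup>2 = 1 - t\<^sup>2"
    using assms(1,2) unfolding power2_norm_eq_inner
    by (simp add: inner_diff_left inner_diff_right inner_commute[of c' c] power2_eq_square
        flip: t_def) (simp add: norm_eq_1 t_def)
  then have "norm (c - t *\<^sub>R c') = sqrt (1 - t\<^sup>2)"
    by (metis norm_ge_zero real_sqrt_unique)
  finally show ?thesis
    using t by (simp add: ang sin_arccos)
qed

section \<open>Bounds on single regrets and on their supremum\<close>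

lemma norm_feature_diff_le:
  assumes "X \<in> instance_sets" "f \<in> feature_maps" "x \<in> X" "y \<in> X"
  shows "norm (f x - f y) \<le> 1"
proof -
  have "dist (f x) (f y) \<le> dist x y"
    using assms lipschitz_onD[of 1 UNIV f x y] by (auto simp: feature_maps_def)
  also have "\<dots> \<le> diameter X"
    using assms by (intro diameter_bounded_bound) (auto simp: instance_sets_def compact_imp_bounded)
  also have "\<dots> \<le> 1"
    using assms by (auto simp: instance_sets_def)
  finally show ?thesis
    by (simp add: dist_norm)
qed

lemma opt_actions_iff:
  "x \<in> opt_actions c X f \<longleftrightarrow> x \<in> X \<and> (\<forall>y\<in>X. f x \<bullet> c \<le> f y \<bullet> c)"
  by (auto simp: opt_actions_def is_arg_min_linorder)

lemma regret_le_1: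
  assumes "norm c = 1" "X \<in> instance_sets" "f \<in> feature_maps" "x \<in> X" "y \<in> X"
  shows "(f x - f y) \<bullet> c \<le> 1"
  using norm_cauchy_schwarz[of "f x - f y" c] norm_feature_diff_le[OF assms(2-5)] assms(1) by simp

lemma regret_le_worst_case_regret:
  assumes "C \<subseteq> sphere 0 1" "feasible_rule p"
    and "c \<in> C" "X \<in> instance_sets" "f \<in> feature_maps" "x \<in> opt_actions c X f"
  shows "(f (p X f) - f x) \<bullet> c \<le> worst_case_regret C p"
  unfolding worst_case_regret_def
proof (rule cSup_upper)
  \<comment> \<open>A real supremum bounds its elements only if the set is bounded above.
    Feasibility puts the chosen action into \<open>X\<close>, so every regret is at most 1.\<close>
  show "bdd_above {(f (p X f) - f x) \<bullet> c | c X f x.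
       c \<in> C \<and> X \<in> instance_sets \<and> f \<in> feature_maps \<and> x \<in> opt_actions c X f}"
  proof (rule bdd_aboveI)
    fix r
    assume "r \<in> {(f (p X f) - f x) \<bullet> c | c X f x.
       c \<in> C \<and> X \<in> instance_sets \<and> f \<in> feature_maps \<and> x \<in> opt_actions c X f}"
    then obtain c X f x where r: "r = (f (p X f) - f x) \<bullet> c"
      and *: "c \<in> C" "X \<in> instance_sets" "f \<in> feature_maps" "x \<in> opt_actions c X f"
      by blast
    have "p X f \<in> X" "norm c = 1"
      using assms(1,2) * by (auto simp: feasible_rule_def)
    with * show "r \<le> 1"
      unfolding r by (intro regret_le_1[of c X]) (auto simp: opt_actions_iff)
  qed
qed (use assms in blast)

lemma worst_case_regret_least:
  fixes p :: "('n::finite, 'd::finite) decision_rule"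
  assumes "C \<noteq> {}"
    and "\<And>c X f x. c \<in> C \<Longrightarrow> X \<in> instance_sets \<Longrightarrow> f \<in> feature_maps \<Longrightarrow> x \<in> opt_actions c X f
           \<Longrightarrow> (f (p X f) - f x) \<bullet> c \<le> b"
  shows "worst_case_regret C p \<le> b"
  unfolding worst_case_regret_def
proof (rule cSup_least)
  \<comment> \<open>Nonemptiness of the set of regrets: a one-point instance with the zero feature
    map has an optimal action for every cost.\<close>
  obtain c where "c \<in> C"
    using assms(1) by blast
  moreover have "{0 :: real ^ 'n} \<in> instance_sets"
    by (simp add: instance_sets_def)
  moreover have "(\<lambda>_. 0 :: real ^ 'd) \<in> (feature_maps :: (real ^ 'n \<Rightarrow> _) set)"
    by (simp add: feature_maps_def lipschitz_on_def)
  moreover have "(0 :: real ^ 'n) \<in> opt_actions c {0} (\<lambda>_. 0)"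
    by (simp add: opt_actions_iff)
  ultimately show "{(f (p X f) - f x) \<bullet> c | c X f x.
       c \<in> C \<and> X \<in> instance_sets \<and> f \<in> feature_maps \<and> x \<in> opt_actions c X f} \<noteq> {}"
    by blast
qed (use assms(2) in blast)

section \<open>Consistent costs and the upper bound\<close>

lemma consistent_costs_subset: "consistent_costs D \<subseteq> sphere 0 1"
  by (auto simp: consistent_costs_def)

lemma consistent_costs_nonempty:
  assumes "valid_dataset D"
  shows "consistent_costs D \<noteq> {}"
proof -
  obtain c where "c \<in> sphere 0 1" "\<forall>(X, f, x)\<in>set D. x \<in> opt_actions c X f"
    using assms by (fastforce simp: valid_dataset_def)
  then have "c \<in> consistent_costs D"
    by (fastforce simp: consistent_costs_def opt_actions_iff inner_commute)
  then show ?thesis by blast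
qed

text \<open>The data matter only through the set \<open>C\<close> of possible costs. Below
  \<open>pi / 2\<close> the projection estimate applies to each cost; from \<open>pi / 2\<close> on,
  the bound 1 comes from the size of the feature difference alone.\<close>

lemma circumcenter_rule_regret_le:
  fixes p :: "('n::finite, 'd::finite) decision_rule"
  assumes C: "C \<subseteq> sphere 0 1" "C \<noteq> {}" and c': "circumcenter C c'"
    and p: "\<And>X f. X \<in> instance_sets \<Longrightarrow> f \<in> feature_maps \<Longrightarrow> p X f \<in> opt_actions c' X f"
  shows "worst_case_regret C p \<le>
           (if uncertainty_angle C < pi / 2 then sin (uncertainty_angle C) else 1)"
proof (rule worst_case_regret_least[OF C(2)])
  fix c f and X :: "(real ^ 'n) set" and x
  assume c: "c \<in> C" and X: "X \<in> instance_sets" and f: "f \<in> feature_maps"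
    and x: "x \<in> opt_actions c X f"
  let ?v = "f (p X f) - f x"
  have unit: "norm c = 1" "norm c' = 1"
    using c C c' by (auto simp: circumcenter_def is_arg_min_def)
  have mem: "p X f \<in> X" "x \<in> X"
    using p[OF X f] x by (auto simp: opt_actions_iff)
  have v: "norm ?v \<le> 1" "?v \<bullet> c' \<le> 0"
    using norm_feature_diff_le[OF X f mem] p[OF X f] mem
    by (auto simp: opt_actions_iff inner_diff_left)
  have le: "angle c c' \<le> uncertainty_angle C"
    by (rule angle_le_uncertainty_angle[OF c' C(1) c])
  show "?v \<bullet> c \<le> (if uncertainty_angle C < pi / 2 then sin (uncertainty_angle C) else 1)"
  proof (cases "uncertainty_angle C < pi / 2")
    case True
    have "?v \<bullet> c \<le> sin (angle c c')"
      using inner_le_sin_angle[OF unit v] le True by simp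
    \<comment> \<open>Both angles lie in the range from 0 to \<open>pi / 2\<close>, where sine
      increases.\<close>
    also have "\<dots> \<le> sin (uncertainty_angle C)"
      using angle_unit_bounds[OF unit] le True by (intro sin_monotone_2pi_le) auto
    finally show ?thesis using True by simp
  next
    case False
    then show ?thesis
      using regret_le_1[OF unit(1) X f mem] by simp
  qed
qed

section \<open>Geometry of spherical caps\<close>

definition spherical_cap :: "real ^ 'd \<Rightarrow> real \<Rightarrow> (real ^ 'd) set" where
  "spherical_cap e a = {c \<in> sphere 0 1. cos a \<le> c \<bullet> e}"

lemma norm_circle_point:
  fixes e u :: "'a::real_inner"
  assumes "norm e = 1" "norm u = 1" "e \<bullet> u = 0" "p\<^sup>2 + q\<^sup>2 = 1"
  shows "norm (p *\<^sub>R e + q *\<^sub>R u) = 1"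
  using assms by (simp add: norm_eq_1 inner_add_left inner_add_right inner_commute[of u e]
      flip: power2_eq_square)

text \<open>The condition on \<open>s\<close> is squared so that it covers both \<open>sin a\<close>
  and \<open>- sin a\<close>, the two mirror images along \<open>u\<close>.\<close>

lemma spherical_cap_rim:
  fixes e u :: "real ^ 'd"
  assumes "norm e = 1" "norm u = 1" "e \<bullet> u = 0" "s\<^sup>2 = (sin a)\<^sup>2"
  shows "cos a *\<^sub>R e + s *\<^sub>R u \<in> spherical_cap e a"
  using norm_circle_point[OF assms(1-3), of "cos a" s] assms
  by (simp add: spherical_cap_def inner_add_left inner_commute[of u e] norm_eq_1)

lemma orthogonal_unit_exists:
  fixes e :: "'a::euclidean_space"
  assumes "2 \<le> DIM('a)"
  obtains u :: 'a where "norm u = 1" "e \<bullet> u = 0"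
proof -
  obtain y :: 'a where "y \<noteq> 0" "orthogonal e y"
    using orthogonal_to_vector_exists[OF assms] by blast
  then show thesis
    by (intro that[of "sgn y"]) (auto simp: norm_sgn sgn_div_norm orthogonal_def)
qed

lemma unit_decomposition:
  fixes e c :: "'a::euclidean_space"
  assumes "2 \<le> DIM('a)" "norm e = 1" "norm c = 1"
  obtains u where "norm u = 1" "e \<bullet> u = 0"
    "c = (c \<bullet> e) *\<^sub>R e + sqrt (1 - (c \<bullet> e)\<^sup>2) *\<^sub>R u"
proof -
  define w where "w = c - (c \<bullet> e) *\<^sub>R e"
  have ew: "e \<bullet> w = 0"
    using assms(2) by (simp add: w_def inner_diff_right inner_commute norm_eq_1)
  have "w \<bullet> w = c \<bullet> w"
    using ew by (simp add: w_def inner_diff_left)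
  also have "\<dots> = 1 - (c \<bullet> e)\<^sup>2"
    using assms(3) by (simp add: w_def inner_diff_right norm_eq_1 power2_eq_square)
  finally have w: "norm w = sqrt (1 - (c \<bullet> e)\<^sup>2)"
    by (simp add: norm_eq_sqrt_inner)
  show thesis
  proof (cases "w = 0")
    case True
    \<comment> \<open>Here \<open>c\<close> is \<open>e\<close> or \<open>- e\<close>, so the
      coefficient of \<open>u\<close> is 0 and any unit vector orthogonal to \<open>e\<close> will
      do.\<close>
    obtain u :: 'a where "norm u = 1" "e \<bullet> u = 0"
      using orthogonal_unit_exists[OF assms(1)] by blast
    then show thesis
      using that[of u] True w by (simp add: w_def)
  next
    case False
    then show thesis
      using ew by (intro that[of "sgn w"])
        (auto simp: norm_sgn sgn_div_norm simp flip: w, simp add: w_def)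
  qed
qed

text \<open>No center is closer than \<open>a\<close> to the whole cap. If the antipode of
  \<open>c'\<close> is in the cap, it is at angle \<open>pi\<close>. Otherwise start at
  \<open>e\<close> and move by the angle \<open>a\<close> directly away from \<open>c'\<close>: the
  angles add up to \<open>arccos p + a\<close>.\<close>

lemma spherical_cap_far_point:
  fixes e c' :: "real ^ 'd"
  assumes d: "CARD('d) \<ge> 2" and e: "norm e = 1" and c': "norm c' = 1" and a: "0 \<le> a" "a \<le> pi"
  obtains c where "c \<in> spherical_cap e a" "c \<bullet> c' \<le> cos a"
proof (cases "- c' \<in> spherical_cap e a")
  case True
  then show thesis
    using c' by (intro that[of "- c'"]) (auto simp: norm_eq_1)
next
  case False
  define p where "p = c' \<bullet> e"
  have p: "-1 \<le> p" "p \<le> 1"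
    using inner_unit_bounds[OF c' e] by (auto simp: p_def)
  \<comment> \<open>That \<open>- c'\<close> lies outside the cap means \<open>- p < cos a\<close>.
    Hence the total arc stays within \<open>pi\<close>, where cosine is still decreasing.\<close>
  have "cos (pi - a) < p"
    using False c' by (simp add: spherical_cap_def p_def)
  then have sum: "arccos p + a \<le> pi"
    using arccos_less_arccos[of "cos (pi - a)" p] arccos_cos[of "pi - a"] p a by simp
  obtain u where u: "norm u = 1" "e \<bullet> u = 0" "c' = p *\<^sub>R e + sqrt (1 - p\<^sup>2) *\<^sub>R u"
    using unit_decomposition[OF _ e c'] d unfolding p_def by auto
  \<comment> \<open>Since \<open>c'\<close> lies on the \<open>u\<close> side of \<open>e\<close>,
    the rim point away from it has coefficient \<open>- sin a\<close>.\<close>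
  let ?c = "cos a *\<^sub>R e + (- sin a) *\<^sub>R u"
  have "?c \<bullet> c' = cos a * p - sin a * sqrt (1 - p\<^sup>2)"
    using e u(1,2) by (subst u(3))
      (simp add: inner_add_left inner_add_right inner_diff_left inner_diff_right
        inner_commute[of u e] norm_eq_1)
  also have "\<dots> = cos (a + arccos p)"
    using p by (simp add: cos_add sin_arccos)
  also have "\<dots> \<le> cos a"
    using a sum p by (intro cos_monotone_0_pi_le) (auto simp: arccos_lbound add.commute)
  finally show thesis
    using spherical_cap_rim[OF e u(1,2), of "- sin a" a] that by simp
qed

text \<open>The far point bounds the largest angle from below for every center; the center
  \<open>e\<close> attains the bound because cosine decreases on the angles in question.\<close>

lemma uncertainty_angle_spherical_cap:
  fixes e :: "real ^ 'd"
  assumes d: "CARD('d) \<ge> 2" and e: "norm e = 1" and a: "0 \<le> a" "a \<le> pi"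
  shows "uncertainty_angle (spherical_cap e a) = a"
proof (rule antisym)
  let ?C = "spherical_cap e a"
  have C: "?C \<subseteq> sphere 0 1"
    by (auto simp: spherical_cap_def)
  have eC: "e \<in> ?C"
    using e by (simp add: spherical_cap_def norm_eq_1)
  have lower: "a \<le> (SUP c\<in>?C. angle c c')" if c': "norm c' = 1" for c' :: "real ^ 'd"
  proof -
    obtain c where c: "c \<in> ?C" "c \<bullet> c' \<le> cos a"
      using spherical_cap_far_point[OF d e c' a] by blast
    have nc: "norm c = 1"
      using c C by auto
    have "a \<le> angle c c'"
      using arccos_le_arccos[of "c \<bullet> c'" "cos a"] c inner_unit_bounds[OF nc c'] a
      by (simp add: angle_unit[OF nc c'] arccos_cos)
    also have "\<dots> \<le> (SUP c\<in>?C. angle c c')"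
      by (rule angle_le_SUP[OF C c' c(1)])
    finally show ?thesis .
  qed
  show "a \<le> uncertainty_angle ?C"
    unfolding uncertainty_angle_def using lower e by (intro cINF_greatest) auto
  have "uncertainty_angle ?C \<le> (SUP c\<in>?C. angle c e)"
    unfolding uncertainty_angle_def using lower e
    by (intro cINF_lower bdd_belowI[of _ a]) auto
  also have "\<dots> \<le> a"
  proof (rule cSUP_least)
    fix c assume c: "c \<in> ?C"
    then have nc: "norm c = 1" "cos a \<le> c \<bullet> e"
      by (auto simp: spherical_cap_def)
    then show "angle c e \<le> a"
      using arccos_le_arccos[of "cos a" "c \<bullet> e"] inner_unit_bounds[OF nc(1) e] a
      by (simp add: angle_unit[OF nc(1) e] arccos_cos)
  qed (use eC in blast)
  finally show "uncertainty_angle ?C \<le> a" .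
qed

section \<open>Two-action instances and the lower bound\<close>

lemma worst_case_regret_mirrored_costs:
  fixes p :: "('n::finite, 'd::finite) decision_rule"
  assumes C: "C \<subseteq> sphere 0 1" and p: "feasible_rule p" and u: "norm u = 1"
    and c: "c1 \<in> C" "c2 \<in> C" and s: "0 \<le> s" "u \<bullet> c1 = s" "u \<bullet> c2 = - s"
  shows "s \<le> worst_case_regret C p"
proof -
  obtain v :: "real ^ 'n" where v: "norm v = 1"
    using vector_choose_size[of 1] by auto
  \<comment> \<open>The rank-one map sends the actions to the features 0 and \<open>u\<close>. As
    \<open>u\<close> and \<open>v\<close> are unit vectors, it is 1-Lipschitz and \<open>?X\<close>
    has diameter 1.\<close>
  let ?X = "{0, v}" and ?f = "\<lambda>x. (x \<bullet> v) *\<^sub>R u"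
  have X: "?X \<in> instance_sets"
    using v by (auto simp: instance_sets_def intro!: diameter_le)
  have f: "?f \<in> feature_maps"
    unfolding feature_maps_def mem_Collect_eq
  proof (rule lipschitz_onI)
    fix x y :: "real ^ 'n"
    have "dist (?f x) (?f y) = \<bar>(x - y) \<bullet> v\<bar>"
      using u by (simp add: dist_norm inner_diff_left flip: scaleR_left_diff_distrib)
    also have "\<dots> \<le> 1 * dist x y"
      using Cauchy_Schwarz_ineq2[of "x - y" v] v by (simp add: dist_norm)
    finally show "dist (?f x) (?f y) \<le> 1 * dist x y" .
  qed simp
  have fv: "?f v = u"
    using v by (simp add: norm_eq_1)
  \<comment> \<open>The rule commits to an action without seeing the cost: \<open>v\<close> loses
    \<open>s\<close> under \<open>c1\<close>, and 0 loses \<open>s\<close> under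
    \<open>c2\<close>.\<close>
  have "p ?X ?f \<in> ?X"
    using p X f by (auto simp: feasible_rule_def)
  then consider "p ?X ?f = v" | "p ?X ?f = 0"
    by blast
  then show ?thesis
  proof cases
    case 1
    have "0 \<in> opt_actions c1 ?X ?f"
      using s v by (simp add: opt_actions_iff norm_eq_1)
    from regret_le_worst_case_regret[OF C p c(1) X f this] show ?thesis
      using 1 fv s by simp
  next
    case 2
    have "v \<in> opt_actions c2 ?X ?f"
      using s v by (simp add: opt_actions_iff norm_eq_1)
    from regret_le_worst_case_regret[OF C p c(2) X f this] show ?thesis
      using 2 fv s by simp
  qed
qed

lemma worst_case_regret_spherical_cap:
  fixes e :: "real ^ 'd::finite" and p :: "('n::finite, 'd) decision_rule"
  assumes d: "CARD('d) \<ge> 2" and e: "norm e = 1" and a: "0 \<le> a" "a \<le> pi" and p: "feasible_rule p"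
  shows "(if a < pi / 2 then sin a else 1) \<le> worst_case_regret (spherical_cap e a) p"
proof -
  obtain u :: "real ^ 'd" where u: "norm u = 1" "e \<bullet> u = 0"
    using orthogonal_unit_exists[of e] d by auto
  have C: "spherical_cap e a \<subseteq> sphere 0 1"
    by (auto simp: spherical_cap_def)
  note mirrored = worst_case_regret_mirrored_costs[OF C p u(1)]
  show ?thesis
  proof (cases "a < pi / 2")
    case True
    have "sin a \<le> worst_case_regret (spherical_cap e a) p"
    proof (rule mirrored)
      show "cos a *\<^sub>R e + sin a *\<^sub>R u \<in> spherical_cap e a"
        "cos a *\<^sub>R e + (- sin a) *\<^sub>R u \<in> spherical_cap e a"
        using spherical_cap_rim[OF e u] by (metis, metis power2_minus)
    qed (use a u in \<open>auto simp: sin_ge_zero inner_add_right inner_diff_right inner_commute[of u e] norm_eq_1\<close>)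
    with True show ?thesis by simp
  next
    case False
    \<comment> \<open>The cap now contains every unit vector orthogonal to \<open>e\<close>. The
      costs \<open>u\<close> and \<open>- u\<close> give the gap 1, where the rim points would give
      \<open>sin a\<close>.\<close>
    then have "cos a \<le> 0"
      using a cos_monotone_0_pi_le[of "pi / 2" a] by simp
    have "1 \<le> worst_case_regret (spherical_cap e a) p"
    proof (rule mirrored)
      show "u \<in> spherical_cap e a" "- u \<in> spherical_cap e a"
        using u \<open>cos a \<le> 0\<close> by (auto simp: spherical_cap_def inner_commute[of u e])
    qed (use u in \<open>auto simp: norm_eq_1\<close>)
    with False show ?thesis by simp
  qed
qed

theorem theorem1:
  assumes "CARD('d::finite) \<ge> 2"
  shows
    "(\<forall>(\<pi> :: ('n::finite, 'd) dataset \<Rightarrow> ('n, 'd) decision_rule) D.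
        circumcenter_policy \<pi> \<and> valid_dataset D \<longrightarrow>
        worst_case_regret (consistent_costs D) (\<pi> D) \<le>
          of_bool (uncertainty_angle (consistent_costs D) < pi / 2)
            * sin (uncertainty_angle (consistent_costs D))
          + of_bool (uncertainty_angle (consistent_costs D) \<ge> pi / 2)) \<and>
     (\<forall>a\<in>{0..pi}. \<exists>C :: (real ^ 'd) set. C \<subseteq> sphere 0 1 \<and> C \<noteq> {} \<and> uncertainty_angle C = a \<and>
        (\<forall>p :: ('n, 'd) decision_rule. feasible_rule p \<longrightarrow>
           worst_case_regret C p \<ge> (if a < pi / 2 then sin a else 1)))"
proof (intro conjI allI impI ballI)
  fix \<pi> :: "('n, 'd) dataset \<Rightarrow> ('n, 'd) decision_rule"
    and D :: "('n, 'd) dataset"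
  assume "circumcenter_policy \<pi> \<and> valid_dataset D"
  then obtain c' where c': "circumcenter (consistent_costs D) c'"
    "\<And>X f. X \<in> instance_sets \<Longrightarrow> f \<in> feature_maps \<Longrightarrow> \<pi> D X f \<in> opt_actions c' X f"
    and D: "valid_dataset D"
    unfolding circumcenter_policy_def by blast
  from circumcenter_rule_regret_le[OF consistent_costs_subset consistent_costs_nonempty[OF D] c']
  show "worst_case_regret (consistent_costs D) (\<pi> D) \<le>
          of_bool (uncertainty_angle (consistent_costs D) < pi / 2)
            * sin (uncertainty_angle (consistent_costs D))
          + of_bool (uncertainty_angle (consistent_costs D) \<ge> pi / 2)"
    by (auto split: if_splits)
next
  fix a :: real
  assume "a \<in> {0..pi}"
  then have a: "0 \<le> a" "a \<le> pi"
    by auto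
  \<comment> \<open>The cap is fixed before the rule; only which of the two mirrored costs is the
    bad one depends on the rule.\<close>
  obtain e :: "real ^ 'd" where e: "norm e = 1"
    using vector_choose_size[of 1] by auto
  then have "e \<in> spherical_cap e a"
    by (simp add: spherical_cap_def norm_eq_1)
  moreover have "spherical_cap e a \<subseteq> sphere 0 1"
    by (auto simp: spherical_cap_def)
  ultimately show "\<exists>C :: (real ^ 'd) set. C \<subseteq> sphere 0 1 \<and> C \<noteq> {} \<and> uncertainty_angle C = a \<and>
        (\<forall>p :: ('n, 'd) decision_rule. feasible_rule p \<longrightarrow>
           worst_case_regret C p \<ge> (if a < pi / 2 then sin a else 1))"
    using uncertainty_angle_spherical_cap[OF assms e a] worst_case_regret_spherical_cap[OF assms e a]
    by (intro exI[of _ "spherical_cap e a"]) blast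
qed

end
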